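(* Let $q$ be an odd prime number and let $p \in \mathbb{N}\setminus\{1\}$ satisfy $1 < p \le q$ or $q+2 \le p \le 2q$. Then every prime divisor of the number $A = \dfrac{p^q-1}{p-1}$ is greater than $p$.
   Context: $\mathbb{N}$ denotes the set of positive integers. The number $p$ is not assumed to be prime. *)

theory Defs
  imports Complex_Main "HOL-Computational_Algebra.Primes"
begin

(* Justifies writing the quotient with natural-number subtraction and div:
   nothing is truncated and the division leaves no remainder. *)
lemma geometric_quotient_exact:
  fixes p q :: nat
  assumes "1 < p"
  shows "real ((p ^ q - 1) div (p - 1)) = (real p ^ q - 1) / (real p - 1)"
proof -
  have "int p - 1 dvd int p ^ q - 1"
    using power_diff_1_eq[of "int p" q] by simp
  then have "int (p - 1) dvd int (p ^ q - 1)"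
    using assms by (simp add: of_nat_diff)
  then have "p - 1 dvd p ^ q - 1"
    by (simp only: int_dvd_int_iff)
  then show ?thesis
    using assms by (simp add: real_of_nat_div of_nat_diff)
qed

end

theory Submission
  imports Defs "HOL-Number_Theory.Number_Theory"
begin

text \<open>
  Let \<open>r\<close> be a prime divisor of \<open>1 + p + \<dots> + p^(q-1)\<close>. The order of \<open>p\<close> modulo \<open>r\<close> divides \<open>q\<close>.
  If it is \<open>1\<close>, the sum is congruent to \<open>q\<close>, so \<open>r = q\<close> divides \<open>p - 1\<close>, which the range of \<open>p\<close>
  excludes. If it is \<open>q\<close>, then \<open>q\<close> divides \<open>r - 1\<close>; as \<open>q\<close> is odd and \<open>r - 1\<close> even, \<open>r > 2q \<ge> p\<close>.
\<close>

lemma geometric_quotient_eq_sum: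
  fixes p n :: nat
  assumes "1 < p"
  shows "(p ^ n - 1) div (p - 1) = (\<Sum>i<n. p ^ i)"
proof -
  have "int (p ^ n - 1) = int ((p - 1) * (\<Sum>i<n. p ^ i))"
    using assms power_diff_1_eq[of "int p" n] by (simp add: of_nat_diff)
  then have "p ^ n - 1 = (p - 1) * (\<Sum>i<n. p ^ i)"
    by (simp only: of_nat_eq_iff)
  then show ?thesis
    using assms by simp
qed

lemma cong_1_geometric_sum:
  fixes p n r :: nat
  assumes "[p = 1] (mod r)"
  shows "[(\<Sum>i<n. p ^ i) = n] (mod r)"
proof -
  have "[p ^ i = 1] (mod r)" for i
    using cong_pow[OF assms, of i] by simp
  then have "[(\<Sum>i<n. p ^ i) = (\<Sum>i<n. 1)] (mod r)"
    by (intro cong_sum)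
  then show ?thesis by simp
qed

text \<open>As \<open>q\<close> is prime, \<open>ord r p\<close> is 1 or \<open>q\<close>; these two
  orders give the two alternatives.\<close>

lemma prime_dvd_geometric_sum_cases:
  fixes p q r :: nat
  assumes "prime q" and "prime r" and "1 < p" and "r dvd (\<Sum>i<q. p ^ i)"
  shows "r = q \<and> q dvd p - 1 \<or> q dvd r - 1"
proof -
  have "int (p ^ q - 1) = int ((p - 1) * (\<Sum>i<q. p ^ i))"
    using assms power_diff_1_eq[of "int p" q] by (simp add: of_nat_diff)
  then have "r dvd p ^ q - 1"
    using assms(4) by (simp only: of_nat_eq_iff dvd_mult)
  then have pow: "[p ^ q = 1] (mod r)"
    using assms(3) by (subst cong_altdef_nat) auto
  then have "ord r p dvd q"
    by (simp only: ord_divides)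
  then consider "ord r p = 1" | "ord r p = q"
    using assms(1) by (auto simp: prime_nat_iff)
  then show ?thesis
  proof cases
    case 1
    then have p1: "[p = 1] (mod r)"
      using ord[of p r] by simp
    then have "r dvd q"
      using cong_1_geometric_sum[of p r q] assms(4) cong_dvd_iff by blast
    then have "r = q"
      using assms(1,2) by (simp add: primes_dvd_imp_eq)
    moreover have "r dvd p - 1"
      using p1 assms(3) by (simp add: cong_altdef_nat)
    ultimately show ?thesis by simp
  next
    case 2
    \<comment> \<open>\<open>ord r p\<close> is 0 by default unless \<open>r\<close> and
      \<open>p\<close> are coprime, and here it is the prime \<open>q\<close>.\<close>
    have "coprime r p"
      using 2 assms(1) ord_eq_0 not_prime_0 by metis
    then have "ord r p dvd totient r"
      by (rule order_divides_totient)
    then show ?thesis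
      using 2 assms(2) by (simp add: totient_prime)
  qed
qed

theorem theorem3:
  fixes p q :: nat
  assumes "prime q" and "odd q"
    and "(1 < p \<and> p \<le> q) \<or> (q + 2 \<le> p \<and> p \<le> 2 * q)"
  shows "\<forall>r::nat. prime r \<and> r dvd (p ^ q - 1) div (p - 1) \<longrightarrow> r > p"
proof (intro allI impI)
  fix r :: nat
  assume r: "prime r \<and> r dvd (p ^ q - 1) div (p - 1)"
  have p: "1 < p" and p2: "p \<le> 2 * q"
    using assms(3) by auto
  have q1: "1 < q"
    using assms(1) by (rule prime_gt_1_nat)
  have r1: "1 < r"
    using r prime_gt_1_nat by blast
  have "\<not> q dvd p - 1"
  proof
    assume "q dvd p - 1"
    then obtain k where k: "p - 1 = q * k" ..
    have "k \<noteq> 0" using k p by (intro notI) simp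
    \<comment> \<open>Otherwise \<open>p - 1\<close> would be at least \<open>2 * q\<close>.\<close>
    moreover have "k < 2" using k p p2 q1 mult_le_mono2[of 2 k q] by linarith
    ultimately have "k = 1" by simp
    \<comment> \<open>Here \<open>p = q + 1\<close>, exactly the value in the gap between the two
      ranges.\<close>
    then show False using k p assms(3) by auto
  qed
  moreover have "r dvd (\<Sum>i<q. p ^ i)"
    using r geometric_quotient_eq_sum[OF p] by simp
  ultimately have qr: "q dvd r - 1"
    using prime_dvd_geometric_sum_cases[OF assms(1) _ p] r by blast
  \<comment> \<open>For \<open>r = 2\<close> the prime \<open>q\<close> would divide 1.\<close>
  then have "r \<noteq> 2" using q1 by auto
  then have "odd r" using r r1 prime_odd_nat by force
  then have "2 * q dvd r - 1"
    using qr assms(2) by (intro divides_mult) auto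
  then have "2 * q \<le> r - 1"
    using r1 by (intro dvd_imp_le) auto
  \<comment> \<open>The inequality is strict because \<open>r\<close> is at least
    \<open>2 * q + 1\<close>.\<close>
  then show "p < r" using p2 r1 by linarith
qed

end
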